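(* Let $G$ be a Lie group with Lie algebra $\mathfrak g$ and let $L=L(g,\xi_2,\xi_3)$ be a Lagrangian on $G\circledS\mathfrak g_2\circledS\mathfrak g_3$ (as a manifold $G\times\mathfrak g\times\mathfrak g$). On the image space of the canonical immersion $${}^{1}T^2G=G\circledS(\mathfrak g\times\mathfrak g)\to G\circledS\mathfrak g_2\circledS\mathfrak g_3:\quad (g,\xi,\dot\xi)\mapsto(g,\xi,\dot\xi)$$ of the trivialized second order tangent bundle, the trivialized Euler–Lagrange equations $$\frac{d}{dt}\frac{\delta L}{\delta\xi_2}=T^*R_g\frac{\delta L}{\delta g}+ad^*_{\xi_2}\frac{\delta L}{\delta\xi_2}+ad^*_{\xi_3}\frac{\delta L}{\delta\xi_3},\qquad \frac{d}{dt}\frac{\delta L}{\delta\xi_3}=ad^*_{\xi_2}\frac{\delta L}{\delta\xi_3}$$ reduce to the trivialized second order Euler–Lagrange equations $$\Big(\frac{d}{dt}-ad^*_\xi\Big)\Big(\frac{\delta L}{\delta\xi}-\frac{d}{dt}\Big(\frac{\delta L}{\delta\dot\xi}\Big)\Big)=T^*R_g\frac{\delta L}{\delta g}.$$ When the Lagrangian $L=L(\xi,\dot\xi)$ does not depend on the group variable, one arrives at the second order Euler–Poincaré equations $$\Big(\frac{d}{dt}-ad^*_\xi\Big)\Big(\frac{\delta L}{\delta\xi}-\frac{d}{dt}\Big(\frac{\delta L}{\delta\dot\xi}\Big)\Big)=0$$ on the reduced space $\mathfrak g\times\mathfrak g$. Here the Cartesian product $\mathfrak g\times\mathfrak g$ can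 be understood as a quotient space of the group ${}^{1}T^2G$ under the action of $G$.
   Context: Conventions. $G$ is a Lie group with identity $e$, $\mathfrak g=T_eG$, $\mathfrak g^*$ its dual. $R_g$ is right translation and $T^*R_g=T_e^*R_g:T_g^*G\to\mathfrak g^*$ is the dual of $T_eR_g$. $Ad_g$ is the tangent map at $e$ of $h\mapsto g^{-1}hg$; the Lie bracket is $[\xi,\eta]=ad_\xi\eta$, the derivative of $Ad_g\eta$ at $g=e$ in the direction $\xi$ (the bracket of right invariant vector fields). $ad^*_\xi$ is the linear algebraic dual of $ad_\xi$: $\langle ad^*_\xi\mu,\eta\rangle=\langle\mu,[\xi,\eta]\rangle$. $\delta L/\delta g\in T^*_gG$ and $\delta L/\delta\xi_2,\delta L/\delta\xi_3\in\mathfrak g^*$ are the partial derivatives of $L$; on the image of the immersion $\xi_2=\xi$, $\xi_3=\dot\xi$, and they are written $\delta L/\delta\xi$, $\delta L/\delta\dot\xi$. Subscripts on $\mathfrak g_2,\mathfrak g_3$ only label copies of $\mathfrak g$. ${}^{1}T^2G=G\circledS(\mathfrak g\times\mathfrak g)$ is the right trivialization of the second order tangent bundle $T^2G$, as a semidirect product group with multiplication of the form $(g,\xi,\bar\xi)(h,\eta,\bar\eta)=(gh,\xi+Ad_{g^{-1}}\eta,\bar\xi+Ad_{g^{-1}}\bar\eta)$, in which $G$ is a subgroup. *)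

theory Defs
  imports "HOL-Analysis.Analysis" "HOL-Algebra.Group_Action"
begin

section \<open>Smooth manifolds in coordinates\<close>

text \<open>
  The domain is meant to be open and finite-dimensional, so that differentiability together with
  the directional derivatives being of class \<open>C^k\<close> amounts to being of class \<open>C^(k+1)\<close>.
\<close>

fun Ck_on :: "nat \<Rightarrow> 'a::real_normed_vector set \<Rightarrow> ('a \<Rightarrow> 'b::real_normed_vector) \<Rightarrow> bool" where
  "Ck_on 0 S f \<longleftrightarrow> continuous_on S f"
| "Ck_on (Suc k) S f \<longleftrightarrow>
     (\<forall>x\<in>S. f differentiable (at x)) \<and> (\<forall>v. Ck_on k S (\<lambda>x. frechet_derivative f (at x) v))"

definition smooth_on :: "'a::real_normed_vector set \<Rightarrow> ('a \<Rightarrow> 'b::real_normed_vector) \<Rightarrow> bool" where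
  "smooth_on S f \<longleftrightarrow> (\<forall>k. Ck_on k S f)"

type_synonym ('m, 'e) chart = "'m set \<times> ('m \<Rightarrow> 'e)"

definition chart_inv :: "('m, 'e) chart \<Rightarrow> 'e \<Rightarrow> 'm" where
  "chart_inv c = inv_into (fst c) (snd c)"

definition is_chart :: "('m::topological_space, 'e::real_normed_vector) chart \<Rightarrow> bool" where
  "is_chart c \<longleftrightarrow> open (fst c) \<and> open (snd c ` fst c) \<and>
     homeomorphism (fst c) (snd c ` fst c) (snd c) (chart_inv c)"

definition smooth_atlas :: "('m::topological_space, 'e::real_normed_vector) chart set \<Rightarrow> bool" where
  "smooth_atlas A \<longleftrightarrow> (\<forall>c\<in>A. is_chart c) \<and> (\<Union>c\<in>A. fst c) = UNIV \<and>
     (\<forall>c\<in>A. \<forall>d\<in>A. smooth_on (snd c ` (fst c \<inter> fst d)) (snd d \<circ> chart_inv c))"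

definition eucl_atlas :: "('e, 'e) chart set" where
  "eucl_atlas = {(UNIV, \<lambda>x. x)}"

definition prod_atlas ::
    "('m, 'e) chart set \<Rightarrow> ('n, 'f) chart set \<Rightarrow> ('m \<times> 'n, 'e \<times> 'f) chart set" where
  "prod_atlas A B = {(fst c \<times> fst d, map_prod (snd c) (snd d)) | c d. c \<in> A \<and> d \<in> B}"

definition smooth_map_on ::
    "('m::topological_space, 'e::real_normed_vector) chart set \<Rightarrow>
     ('n::topological_space, 'f::real_normed_vector) chart set \<Rightarrow> 'm set \<Rightarrow> ('m \<Rightarrow> 'n) \<Rightarrow> bool" where
  "smooth_map_on A B S f \<longleftrightarrow> continuous_on S f \<and>
     (\<forall>c\<in>A. \<forall>d\<in>B. smooth_on (snd c ` (fst c \<inter> S \<inter> f -` fst d)) (snd d \<circ> f \<circ> chart_inv c))"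

text \<open>
  One chart is selected around each point, and the tangent space at the point is identified with
  the model space by the differential of that chart.  Tangent maps are then derivatives read in
  the selected charts, so that the chain rule holds for them without change of coordinates.
\<close>

definition chart_at :: "('m, 'e) chart set \<Rightarrow> 'm \<Rightarrow> ('m, 'e) chart" where
  "chart_at A p = (SOME c. c \<in> A \<and> p \<in> fst c)"

definition tangent_map ::
    "('m, 'e::real_normed_vector) chart set \<Rightarrow> ('n, 'f::real_normed_vector) chart set \<Rightarrow>
     ('m \<Rightarrow> 'n) \<Rightarrow> 'm \<Rightarrow> 'e \<Rightarrow> 'f" where
  "tangent_map A B f p =
     frechet_derivative (snd (chart_at B (f p)) \<circ> f \<circ> chart_inv (chart_at A p))
       (at (snd (chart_at A p) p))"


section \<open>Lie groups\<close>

text \<open>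
  The model space is an arbitrary finite-dimensional inner product space, since the class
  \<^class>\<open>euclidean_space\<close> would exclude dimension zero.  The inner product plays no role:
  the cotangent spaces, and the dual of the Lie algebra, are the spaces of linear functionals
  \<open>'e \<Rightarrow>\<^sub>L real\<close>.
\<close>

locale lie_group = group G
  for G :: "'g::{t2_space, second_countable_topology} monoid" (structure) +
  fixes A :: "('g, 'e::real_inner) chart set"
  assumes carrier_UNIV: "carrier G = UNIV"
    and finite_dim: "\<exists>B::'e set. finite B \<and> span B = UNIV"
    and atlas: "smooth_atlas A"
    and smooth_mult: "smooth_map_on (prod_atlas A A) A UNIV (\<lambda>(g, h). g \<otimes> h)"
    and smooth_inv: "smooth_map_on A A UNIV (\<lambda>g. inv g)"

definition Ad ::
    "'g monoid \<Rightarrow> ('g, 'e::real_normed_vector) chart set \<Rightarrow> 'g \<Rightarrow> 'e \<Rightarrow> 'e" where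
  "Ad G A g = tangent_map A A (\<lambda>h. inv\<^bsub>G\<^esub> g \<otimes>\<^bsub>G\<^esub> h \<otimes>\<^bsub>G\<^esub> g) \<one>\<^bsub>G\<^esub>"

definition ad ::
    "'g monoid \<Rightarrow> ('g, 'e::real_normed_vector) chart set \<Rightarrow> 'e \<Rightarrow> 'e \<Rightarrow> 'e" where
  "ad G A \<xi> \<eta> = tangent_map A eucl_atlas (\<lambda>g. Ad G A g \<eta>) \<one>\<^bsub>G\<^esub> \<xi>"

definition ad_star ::
    "'g monoid \<Rightarrow> ('g, 'e::real_normed_vector) chart set \<Rightarrow> 'e \<Rightarrow> ('e \<Rightarrow>\<^sub>L real) \<Rightarrow> ('e \<Rightarrow>\<^sub>L real)" where
  "ad_star G A \<xi> \<mu> = Blinfun (\<lambda>\<eta>. blinfun_apply \<mu> (ad G A \<xi> \<eta>))"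

definition cotangent_right ::
    "'g monoid \<Rightarrow> ('g, 'e::real_normed_vector) chart set \<Rightarrow> 'g \<Rightarrow> ('e \<Rightarrow>\<^sub>L real) \<Rightarrow> ('e \<Rightarrow>\<^sub>L real)" where
  "cotangent_right G A g \<alpha> =
     Blinfun (\<lambda>\<eta>. blinfun_apply \<alpha> (tangent_map A A (\<lambda>h. h \<otimes>\<^bsub>G\<^esub> g) \<one>\<^bsub>G\<^esub> \<eta>))"


section \<open>The trivialized second order tangent bundle\<close>

definition triv_T2 ::
    "'g monoid \<Rightarrow> ('g, 'e::real_normed_vector) chart set \<Rightarrow> ('g \<times> 'e \<times> 'e) monoid" where
  "triv_T2 G A = \<lparr> carrier = UNIV,
     mult = (\<lambda>(g, \<xi>, \<xi>') (h, \<eta>, \<eta>').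
       (g \<otimes>\<^bsub>G\<^esub> h, \<xi> + Ad G A (inv\<^bsub>G\<^esub> g) \<eta>, \<xi>' + Ad G A (inv\<^bsub>G\<^esub> g) \<eta>')),
     one = (\<one>\<^bsub>G\<^esub>, 0, 0) \<rparr>"

definition embed_G :: "'g \<Rightarrow> 'g \<times> 'e::zero \<times> 'e" where
  "embed_G g = (g, 0, 0)"

text \<open>
  The group acts by right multiplication through its embedding, which in the right trivialization
  moves only the group variable.  The inverse turns this right action into a left one.
\<close>

definition G_action ::
    "'g monoid \<Rightarrow> ('g, 'e::real_normed_vector) chart set \<Rightarrow> 'g \<Rightarrow> 'g \<times> 'e \<times> 'e \<Rightarrow> 'g \<times> 'e \<times> 'e" where
  "G_action G A h x = x \<otimes>\<^bsub>triv_T2 G A\<^esub> embed_G (inv\<^bsub>G\<^esub> h)"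

text \<open>
  The relation \<open>dg/dt = TR\<^sub>g \<xi>\<close> of a curve lifted from the group occurs in none of the equations
  and is not imposed, so lifted curves are a special case.
\<close>

definition second_order_curve ::
    "(real \<Rightarrow> 'g) \<Rightarrow> (real \<Rightarrow> 'e::real_normed_vector) \<Rightarrow> real \<Rightarrow> 'g \<times> 'e \<times> 'e" where
  "second_order_curve g \<xi> t = (g t, \<xi> t, vector_derivative \<xi> (at t))"

text \<open>The target is the manifold of all triples \<open>(g, \<xi>\<^sub>2, \<xi>\<^sub>3)\<close>.\<close>

definition canonical_immersion :: "'g \<times> 'e \<times> 'e \<Rightarrow> 'g \<times> 'e \<times> 'e" where
  "canonical_immersion = (\<lambda>(g, \<xi>, \<xi>'). (g, \<xi>, \<xi>'))"


section \<open>Euler--Lagrange and Euler--Poincare equations\<close>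

definition deriv_group ::
    "('g, 'e::real_normed_vector) chart set \<Rightarrow> ('g \<times> 'e \<times> 'e \<Rightarrow> real) \<Rightarrow> 'g \<times> 'e \<times> 'e \<Rightarrow> ('e \<Rightarrow>\<^sub>L real)" where
  "deriv_group A L = (\<lambda>(g, \<xi>, \<eta>). Blinfun (tangent_map A eucl_atlas (\<lambda>h. L (h, \<xi>, \<eta>)) g))"

definition deriv_xi2 ::
    "('g \<times> 'e \<times> 'e \<Rightarrow> real) \<Rightarrow> 'g \<times> 'e \<times> 'e \<Rightarrow> ('e::real_normed_vector \<Rightarrow>\<^sub>L real)" where
  "deriv_xi2 L = (\<lambda>(g, \<xi>, \<eta>). Blinfun (frechet_derivative (\<lambda>x. L (g, x, \<eta>)) (at \<xi>)))"

definition deriv_xi3 ::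
    "('g \<times> 'e \<times> 'e \<Rightarrow> real) \<Rightarrow> 'g \<times> 'e \<times> 'e \<Rightarrow> ('e::real_normed_vector \<Rightarrow>\<^sub>L real)" where
  "deriv_xi3 L = (\<lambda>(g, \<xi>, \<eta>). Blinfun (frechet_derivative (\<lambda>y. L (g, \<xi>, y)) (at \<eta>)))"

definition deriv_fst ::
    "('e \<times> 'e \<Rightarrow> real) \<Rightarrow> 'e \<times> 'e \<Rightarrow> ('e::real_normed_vector \<Rightarrow>\<^sub>L real)" where
  "deriv_fst l = (\<lambda>(\<xi>, \<eta>). Blinfun (frechet_derivative (\<lambda>x. l (x, \<eta>)) (at \<xi>)))"

definition deriv_snd ::
    "('e \<times> 'e \<Rightarrow> real) \<Rightarrow> 'e \<times> 'e \<Rightarrow> ('e::real_normed_vector \<Rightarrow>\<^sub>L real)" where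
  "deriv_snd l = (\<lambda>(\<xi>, \<eta>). Blinfun (frechet_derivative (\<lambda>y. l (\<xi>, y)) (at \<eta>)))"

text \<open>Every equation below includes the existence of the time derivatives occurring in it.\<close>

definition EL_first ::
    "'g monoid \<Rightarrow> ('g, 'e::real_normed_vector) chart set \<Rightarrow> ('g \<times> 'e \<times> 'e \<Rightarrow> real) \<Rightarrow>
     real set \<Rightarrow> (real \<Rightarrow> 'g \<times> 'e \<times> 'e) \<Rightarrow> bool" where
  "EL_first G A L I c \<longleftrightarrow> (\<forall>t\<in>I. case c t of (g, \<xi>\<^sub>2, \<xi>\<^sub>3) \<Rightarrow>
     ((\<lambda>s. deriv_xi2 L (c s)) has_vector_derivative
        cotangent_right G A g (deriv_group A L (c t)) + ad_star G A \<xi>\<^sub>2 (deriv_xi2 L (c t))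
          + ad_star G A \<xi>\<^sub>3 (deriv_xi3 L (c t))) (at t))"

definition EL_second ::
    "'g monoid \<Rightarrow> ('g, 'e::real_normed_vector) chart set \<Rightarrow> ('g \<times> 'e \<times> 'e \<Rightarrow> real) \<Rightarrow>
     real set \<Rightarrow> (real \<Rightarrow> 'g \<times> 'e \<times> 'e) \<Rightarrow> bool" where
  "EL_second G A L I c \<longleftrightarrow> (\<forall>t\<in>I. case c t of (g, \<xi>\<^sub>2, \<xi>\<^sub>3) \<Rightarrow>
     ((\<lambda>s. deriv_xi3 L (c s)) has_vector_derivative ad_star G A \<xi>\<^sub>2 (deriv_xi3 L (c t))) (at t))"

definition trivialized_EL ::
    "'g monoid \<Rightarrow> ('g, 'e::real_normed_vector) chart set \<Rightarrow> ('g \<times> 'e \<times> 'e \<Rightarrow> real) \<Rightarrow>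
     real set \<Rightarrow> (real \<Rightarrow> 'g \<times> 'e \<times> 'e) \<Rightarrow> bool" where
  "trivialized_EL G A L I c \<longleftrightarrow> EL_first G A L I c \<and> EL_second G A L I c"

text \<open>\<open>coad_eq G A \<xi> p F t\<close> is the equation \<open>(d/dt - ad*\<^sub>\<xi>) p = F\<close> at time \<open>t\<close>.\<close>

definition coad_eq ::
    "'g monoid \<Rightarrow> ('g, 'e::real_normed_vector) chart set \<Rightarrow> (real \<Rightarrow> 'e) \<Rightarrow>
     (real \<Rightarrow> ('e \<Rightarrow>\<^sub>L real)) \<Rightarrow> ('e \<Rightarrow>\<^sub>L real) \<Rightarrow> real \<Rightarrow> bool" where
  "coad_eq G A \<xi> p F t \<longleftrightarrow>
     (\<exists>p'. (p has_vector_derivative p') (at t) \<and> p' - ad_star G A (\<xi> t) (p t) = F)"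

definition second_order_EL ::
    "'g monoid \<Rightarrow> ('g, 'e::real_normed_vector) chart set \<Rightarrow> ('g \<times> 'e \<times> 'e \<Rightarrow> real) \<Rightarrow>
     real set \<Rightarrow> (real \<Rightarrow> 'g) \<Rightarrow> (real \<Rightarrow> 'e) \<Rightarrow> bool" where
  "second_order_EL G A L I g \<xi> \<longleftrightarrow> (let c = second_order_curve g \<xi> in
     \<exists>q. (\<forall>t\<in>I. ((\<lambda>s. deriv_xi3 L (c s)) has_vector_derivative q t) (at t)) \<and>
         (\<forall>t\<in>I. coad_eq G A \<xi> (\<lambda>s. deriv_xi2 L (c s) - q s)
                  (cotangent_right G A (g t) (deriv_group A L (c t))) t))"

definition second_order_EP ::
    "'g monoid \<Rightarrow> ('g, 'e::real_normed_vector) chart set \<Rightarrow> ('e \<times> 'e \<Rightarrow> real) \<Rightarrow>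
     real set \<Rightarrow> (real \<Rightarrow> 'e) \<Rightarrow> bool" where
  "second_order_EP G A l I \<xi> \<longleftrightarrow> (let c = (\<lambda>t. (\<xi> t, vector_derivative \<xi> (at t))) in
     \<exists>q. (\<forall>t\<in>I. ((\<lambda>s. deriv_snd l (c s)) has_vector_derivative q t) (at t)) \<and>
         (\<forall>t\<in>I. coad_eq G A \<xi> (\<lambda>s. deriv_fst l (c s) - q s) 0 t))"

end

theory Submission
  imports Defs
begin

text \<open>
  The second equation identifies \<open>d/dt (\<delta>L/\<delta>\<xi>\<^sub>3)\<close> with \<open>q = ad*\<^sub>\<xi> (\<delta>L/\<delta>\<xi>\<^sub>3)\<close>.  As \<open>ad*\<close> is
  bilinear, the product rule gives \<open>dq/dt = ad*\<^sub>\<xi>' (\<delta>L/\<delta>\<xi>\<^sub>3) + ad*\<^sub>\<xi> q\<close>, and subtracting this from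
  the first equation leaves exactly the second order equation for \<open>\<delta>L/\<delta>\<xi> - q\<close>.  The analytic
  point is the bilinearity of \<open>ad\<close>: linearity in the first argument needs \<open>Ad\<close> to be
  differentiable in the group variable.  The embedded copy of \<open>G\<close> moves only the group variable,
  so its orbits are the fibres of the projection to \<open>\<gg> \<times> \<gg>\<close>.
\<close>

section \<open>Maps between manifolds, differentiable in the selected charts\<close>

lemma smooth_on_imp_differentiable:
  assumes "smooth_on S f" "x \<in> S"
  shows "f differentiable (at x)"
proof -
  have "Ck_on (Suc 0) S f" using assms(1) unfolding smooth_on_def by (rule spec)
  then show ?thesis using assms(2) by simp
qed

lemma smooth_on_frechet_derivative:
  assumes "smooth_on S f"
  shows "smooth_on S (\<lambda>x. frechet_derivative f (at x) v)"
  unfolding smooth_on_def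
proof
  fix k
  have "Ck_on (Suc k) S f" using assms unfolding smooth_on_def by (rule spec)
  then show "Ck_on k S (\<lambda>x. frechet_derivative f (at x) v)" by simp
qed

section \<open>Charts and their inverses\<close>

lemma chart_at_mem:
  assumes "smooth_atlas A"
  shows "chart_at A p \<in> A" and "p \<in> fst (chart_at A p)"
proof -
  have "\<exists>c. c \<in> A \<and> p \<in> fst c"
    using assms unfolding smooth_atlas_def by blast
  then have "chart_at A p \<in> A \<and> p \<in> fst (chart_at A p)"
    unfolding chart_at_def by (rule someI_ex)
  then show "chart_at A p \<in> A" and "p \<in> fst (chart_at A p)" by auto
qed

lemma chart_at_eucl_atlas: "chart_at eucl_atlas x = (UNIV, \<lambda>x. x)"
  unfolding chart_at_def eucl_atlas_def by auto

lemma is_chart_chart_at: "smooth_atlas A \<Longrightarrow> is_chart (chart_at A p)"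
  using chart_at_mem(1) unfolding smooth_atlas_def by blast

lemma chart_inv_chart:
  assumes "is_chart c" "p \<in> fst c"
  shows "chart_inv c (snd c p) = p"
  using assms unfolding is_chart_def homeomorphism_def by blast

lemma chart_chart_inv:
  assumes "is_chart c" "x \<in> snd c ` fst c"
  shows "snd c (chart_inv c x) = x" "chart_inv c x \<in> fst c"
  using assms unfolding is_chart_def homeomorphism_def by auto

lemma isCont_chart_inv:
  assumes "is_chart c" "p \<in> fst c"
  shows "isCont (chart_inv c) (snd c p)"
  using assms unfolding is_chart_def homeomorphism_def
  by (metis continuous_on_eq_continuous_at image_eqI)

lemma eventually_chart_image:
  assumes "is_chart c" "p \<in> fst c"
  shows "\<forall>\<^sub>F x in nhds (snd c p). x \<in> snd c ` fst c"
  using assms unfolding is_chart_def by (metis eventually_nhds_in_open image_eqI)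

text \<open>Continuity of the chart inverse and of \<open>f\<close> keeps values in an open set near
  \<open>snd c p\<close>. Applied to a chart domain, this licenses inserting a chart followed by its
  inverse between two maps.\<close>

lemma eventually_chart_inv:
  assumes "is_chart c" "p \<in> fst c" "isCont f p" "open V" "f p \<in> V"
  shows "\<forall>\<^sub>F x in nhds (snd c p). f (chart_inv c x) \<in> V"
proof -
  have "isCont (\<lambda>x. f (chart_inv c x)) (snd c p)"
    using isCont_o2[OF isCont_chart_inv[OF assms(1,2)]] assms(3)
    by (simp add: chart_inv_chart[OF assms(1,2)])
  then have "filterlim (\<lambda>x. f (chart_inv c x)) (nhds (f p)) (nhds (snd c p))"
    using chart_inv_chart[OF assms(1,2)] by (metis isCont_def tendsto_at_iff_tendsto_nhds)
  then show ?thesis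
    using topological_tendstoD[OF _ assms(4,5)] by blast
qed

text \<open>A derivative depends only on the germ. Coordinate expressions agree merely near the base
  point, since \<open>chart_inv\<close> inverts the chart only on its image.\<close>

lemma has_derivative_eventually_eq:
  assumes "(f has_derivative D) (at x)" "\<forall>\<^sub>F y in nhds x. f y = g y"
  shows "(g has_derivative D) (at x)"
  using assms has_derivative_transform_eventually[OF assms(1), of g] eventually_nhds_x_imp_x[OF assms(2)]
  by (simp add: eventually_nhds_conv_at)

section \<open>Differentiable maps and the chain rule\<close>

text \<open>Continuity is a separate clause: a chart is a total function with arbitrary values off
  its domain, so a differentiable coordinate expression does not force \<open>f\<close> to stay in
  the chart near \<open>p\<close>.\<close>

definition mdiff ::
    "('m::t2_space, 'e::real_normed_vector) chart set \<Rightarrow>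
     ('n::topological_space, 'f::real_normed_vector) chart set \<Rightarrow> ('m \<Rightarrow> 'n) \<Rightarrow> 'm \<Rightarrow> bool" where
  "mdiff A B f p \<longleftrightarrow> isCont f p \<and>
     (snd (chart_at B (f p)) \<circ> f \<circ> chart_inv (chart_at A p)) differentiable
       (at (snd (chart_at A p) p))"

lemma mdiff_has_derivative:
  assumes "mdiff A B f p"
  shows "((snd (chart_at B (f p)) \<circ> f \<circ> chart_inv (chart_at A p)) has_derivative
    tangent_map A B f p) (at (snd (chart_at A p) p))"
  using assms unfolding mdiff_def tangent_map_def by (simp add: frechet_derivative_works)

lemma mdiff_bounded_linear: "mdiff A B f p \<Longrightarrow> bounded_linear (tangent_map A B f p)"
  by (rule has_derivative_bounded_linear[OF mdiff_has_derivative])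

text \<open>Both factors read \<open>f p\<close> in the same selected chart. By continuity of
  \<open>f\<close> that chart cancels with its inverse near \<open>p\<close>, and the ordinary chain
  rule applies with no transition map.\<close>

lemma mdiff_comp:
  assumes A: "smooth_atlas A" and B: "smooth_atlas B"
    and f: "mdiff A B f p" and k: "mdiff B C k (f p)"
  shows "mdiff A C (\<lambda>x. k (f x)) p"
    and "tangent_map A C (\<lambda>x. k (f x)) p = tangent_map B C k (f p) \<circ> tangent_map A B f p"
proof -
  let ?a = "chart_at A p" and ?b = "chart_at B (f p)" and ?c = "chart_at C (k (f p))"
  note ca = is_chart_chart_at[OF A, of p] chart_at_mem(2)[OF A, of p]
  note cb = is_chart_chart_at[OF B, of "f p"] chart_at_mem(2)[OF B, of "f p"]
  have fc: "isCont f p" using f unfolding mdiff_def by blast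
  have inv: "(snd ?b \<circ> f \<circ> chart_inv ?a) (snd ?a p) = snd ?b (f p)"
    using chart_inv_chart[OF ca] by simp
  have d: "((snd ?c \<circ> k \<circ> chart_inv ?b) \<circ> (snd ?b \<circ> f \<circ> chart_inv ?a) has_derivative
      tangent_map B C k (f p) \<circ> tangent_map A B f p) (at (snd ?a p))"
    by (rule diff_chain_at[OF mdiff_has_derivative[OF f]])
       (use mdiff_has_derivative[OF k] inv in simp)
  have "open (fst ?b)" using cb(1) unfolding is_chart_def by blast
  then have "\<forall>\<^sub>F x in nhds (snd ?a p). f (chart_inv ?a x) \<in> fst ?b"
    using eventually_chart_inv[OF ca fc] cb(2) by blast
  then have ev: "\<forall>\<^sub>F x in nhds (snd ?a p). ((snd ?c \<circ> k \<circ> chart_inv ?b) \<circ> (snd ?b \<circ> f \<circ> chart_inv ?a)) x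
       = (snd ?c \<circ> (\<lambda>x. k (f x)) \<circ> chart_inv ?a) x"
    by eventually_elim (simp add: chart_inv_chart[OF cb(1)])
  have d': "((snd ?c \<circ> (\<lambda>x. k (f x)) \<circ> chart_inv ?a) has_derivative
      tangent_map B C k (f p) \<circ> tangent_map A B f p) (at (snd ?a p))"
    by (rule has_derivative_eventually_eq[OF d ev])
  have "isCont (\<lambda>x. k (f x)) p"
    using isCont_o2[OF fc] k unfolding mdiff_def by blast
  then show "mdiff A C (\<lambda>x. k (f x)) p"
    using d' unfolding mdiff_def differentiable_def by blast
  show "tangent_map A C (\<lambda>x. k (f x)) p = tangent_map B C k (f p) \<circ> tangent_map A B f p"
    unfolding tangent_map_def[of A C] using frechet_derivative_at[OF d'] by simp
qed

lemma tangent_map_id: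
  assumes A: "smooth_atlas A"
  shows "tangent_map A A (\<lambda>x. x) p = id"
proof -
  let ?a = "chart_at A p"
  note ca = is_chart_chart_at[OF A, of p] chart_at_mem(2)[OF A, of p]
  have ev: "\<forall>\<^sub>F x in nhds (snd ?a p). id x = (snd ?a \<circ> (\<lambda>x. x) \<circ> chart_inv ?a) x"
    using eventually_chart_image[OF ca]
    by eventually_elim (simp add: chart_chart_inv[OF ca(1)])
  have "((snd ?a \<circ> (\<lambda>x. x) \<circ> chart_inv ?a) has_derivative id) (at (snd ?a p))"
    by (rule has_derivative_eventually_eq[OF _ ev]) (simp add: id_def)
  then show ?thesis
    unfolding tangent_map_def using frechet_derivative_at by fastforce
qed

lemma tangent_map_const: "tangent_map A eucl_atlas (\<lambda>x. k) p = (\<lambda>v. 0)"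
  unfolding tangent_map_def by (simp add: chart_at_eucl_atlas comp_def)

text \<open>An orthogonal spanning set may contain 0; its coefficient is then \<open>_ / 0 = 0\<close>.\<close>

lemma orthogonal_expansion:
  fixes C :: "'e::real_inner set"
  assumes "finite C" "pairwise orthogonal C" "x \<in> span C"
  shows "x = (\<Sum>c\<in>C. (x \<bullet> c / (c \<bullet> c)) *\<^sub>R c)"
proof -
  have "(x - (\<Sum>c\<in>C. (x \<bullet> c / (c \<bullet> c)) *\<^sub>R c)) \<in> span C"
    by (intro span_diff assms span_sum span_scale span_base)
  moreover have "orthogonal (x - (\<Sum>c\<in>C. (x \<bullet> c / (c \<bullet> c)) *\<^sub>R c)) d" if "d \<in> C" for d
  proof -
    have "(x \<bullet> c / (c \<bullet> c)) * (c \<bullet> d) = (if c = d then x \<bullet> d else 0)" if "c \<in> C" for c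
      using assms(2) that \<open>d \<in> C\<close> by (auto simp: pairwise_def orthogonal_def)
    then show ?thesis
      using that assms(1) by (simp add: orthogonal_def inner_diff_left inner_sum_left)
  qed
  \<comment> \<open>The remainder lies in the span and is orthogonal to the spanning set, hence to
    itself.\<close>
  ultimately have "orthogonal (x - (\<Sum>c\<in>C. (x \<bullet> c / (c \<bullet> c)) *\<^sub>R c)) (x - (\<Sum>c\<in>C. (x \<bullet> c / (c \<bullet> c)) *\<^sub>R c))"
    by (rule orthogonal_to_span)
  then show ?thesis by (simp add: orthogonal_self)
qed

section \<open>The adjoint representation\<close>

lemma prod_chart_inv:
  assumes "is_chart c" "is_chart d" "p \<in> fst c" "q \<in> fst d"
  shows "chart_inv (fst c \<times> fst d, map_prod (snd c) (snd d)) (snd c p, snd d q) = (p, q)"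
proof -
  have "inj_on (snd c) (fst c)" "inj_on (snd d) (fst d)"
    using assms by (metis chart_inv_chart inj_on_inverseI)+
  then have "inj_on (map_prod (snd c) (snd d)) (fst c \<times> fst d)"
    by (rule map_prod_inj_on)
  from inv_into_f_f[OF this, of "(p, q)"] show ?thesis
    using assms(3,4) by (simp add: chart_inv_def)
qed

context lie_group
begin

lemma atlas_chart [simp]: "is_chart (chart_at A p)" "p \<in> fst (chart_at A p)" "chart_at A p \<in> A"
  using is_chart_chart_at chart_at_mem atlas by blast+

lemma mem_carrier [simp]: "x \<in> carrier G"
  by (simp add: carrier_UNIV)

text \<open>Three charts are kept apart because the selected charts at \<open>g\<close>,
  \<open>h\<close> and \<open>g \<otimes> h\<close> may all differ; for \<open>Ad\<close> all three
  become the chart at \<open>\<one>\<close>.\<close>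

definition mult_rep :: "('g, 'e) chart \<Rightarrow> ('g, 'e) chart \<Rightarrow> ('g, 'e) chart \<Rightarrow> 'e \<times> 'e \<Rightarrow> 'e" where
  "mult_rep a b c = snd c \<circ> (\<lambda>(g, h). g \<otimes> h) \<circ> chart_inv (fst a \<times> fst b, map_prod (snd a) (snd b))"

lemma mult_rep_smooth:
  assumes "a \<in> A" "b \<in> A" "c \<in> A"
  shows "smooth_on {(snd a g, snd b h) |g h. g \<in> fst a \<and> h \<in> fst b \<and> g \<otimes> h \<in> fst c} (mult_rep a b c)"
proof -
  have "(fst a \<times> fst b, map_prod (snd a) (snd b)) \<in> prod_atlas A A"
    using assms unfolding prod_atlas_def by blast
  then have "smooth_on (map_prod (snd a) (snd b) `
      ((fst a \<times> fst b) \<inter> UNIV \<inter> (\<lambda>(g, h). g \<otimes> h) -` fst c)) (mult_rep a b c)"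
    using smooth_mult assms(3) unfolding smooth_map_on_def mult_rep_def by fastforce
  moreover have "map_prod (snd a) (snd b) ` ((fst a \<times> fst b) \<inter> UNIV \<inter> (\<lambda>(g, h). g \<otimes> h) -` fst c)
     = {(snd a g, snd b h) |g h. g \<in> fst a \<and> h \<in> fst b \<and> g \<otimes> h \<in> fst c}"
    by force
  ultimately show ?thesis by simp
qed

lemma mult_rep_eq:
  assumes "is_chart a" "is_chart b" "g \<in> fst a" "h \<in> fst b"
  shows "mult_rep a b c (snd a g, snd b h) = snd c (g \<otimes> h)"
  unfolding mult_rep_def using prod_chart_inv[OF assms] by simp

lemma mult_rep_has_derivative:
  assumes "a \<in> A" "b \<in> A" "c \<in> A" "g \<in> fst a" "h \<in> fst b" "g \<otimes> h \<in> fst c"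
  shows "(mult_rep a b c has_derivative
    frechet_derivative (mult_rep a b c) (at (snd a g, snd b h))) (at (snd a g, snd b h))"
proof -
  have "mult_rep a b c differentiable (at (snd a g, snd b h))"
    by (rule smooth_on_imp_differentiable[OF mult_rep_smooth[OF assms(1-3)]]) (use assms in auto)
  then show ?thesis by (simp add: frechet_derivative_works)
qed

lemma continuous_on_mult_UNIV: "continuous_on UNIV (\<lambda>(g, h). g \<otimes> h)"
  using smooth_mult unfolding smooth_map_on_def by blast

lemma isCont_mult_left: "isCont (\<lambda>h. g \<otimes> h) p"
proof -
  have "continuous_on UNIV (\<lambda>h. (\<lambda>(g, h). g \<otimes> h) (g, h))"
    by (rule continuous_on_compose2[OF continuous_on_mult_UNIV]) (intro continuous_intros subset_UNIV)+
  then show ?thesis by (simp add: continuous_on_eq_continuous_at)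
qed

lemma isCont_mult_right: "isCont (\<lambda>h. h \<otimes> g) p"
proof -
  have "continuous_on UNIV (\<lambda>h. (\<lambda>(g, h). g \<otimes> h) (h, g))"
    by (rule continuous_on_compose2[OF continuous_on_mult_UNIV]) (intro continuous_intros subset_UNIV)+
  then show ?thesis by (simp add: continuous_on_eq_continuous_at)
qed

lemma isCont_inv: "isCont (\<lambda>g. inv g) p"
  using smooth_inv unfolding smooth_map_on_def by (simp add: continuous_on_eq_continuous_at)

text \<open>Translation is multiplication with one slot frozen, so its coordinate expression is a
  slice of \<open>mult_rep\<close> and its differential a partial differential.\<close>

lemma mult_left_mdiff: "mdiff A A (\<lambda>h. g \<otimes> h) p"
proof -
  let ?a = "chart_at A g" and ?b = "chart_at A p" and ?c = "chart_at A (g \<otimes> p)"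
  let ?m = "mult_rep ?a ?b ?c"
  have p: "((\<lambda>y. (snd ?a g, y)) has_derivative (\<lambda>v. (0, v))) (at (snd ?b p))"
    by (auto intro!: derivative_eq_intros)
  have d: "((\<lambda>y. ?m (snd ?a g, y)) has_derivative
      (\<lambda>v. frechet_derivative ?m (at (snd ?a g, snd ?b p)) (0, v))) (at (snd ?b p))"
    using has_derivative_compose[OF p, of ?m] mult_rep_has_derivative[of ?a ?b ?c g p] by simp
  have ev: "\<forall>\<^sub>F y in nhds (snd ?b p). ?m (snd ?a g, y) = (snd ?c \<circ> (\<lambda>h. g \<otimes> h) \<circ> chart_inv ?b) y"
    using eventually_chart_image[OF atlas_chart(1,2), of p]
    by eventually_elim (auto simp: mult_rep_eq chart_inv_chart)
  have "((snd ?c \<circ> (\<lambda>h. g \<otimes> h) \<circ> chart_inv ?b) has_derivative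
      (\<lambda>v. frechet_derivative ?m (at (snd ?a g, snd ?b p)) (0, v))) (at (snd ?b p))"
    by (rule has_derivative_eventually_eq[OF d ev])
  then show ?thesis
    unfolding mdiff_def differentiable_def using isCont_mult_left by blast
qed

lemma mult_right_mdiff: "mdiff A A (\<lambda>h. h \<otimes> g) p"
proof -
  let ?a = "chart_at A g" and ?b = "chart_at A p" and ?c = "chart_at A (p \<otimes> g)"
  let ?m = "mult_rep ?b ?a ?c"
  have p: "((\<lambda>y. (y, snd ?a g)) has_derivative (\<lambda>v. (v, 0))) (at (snd ?b p))"
    by (auto intro!: derivative_eq_intros)
  have d: "((\<lambda>y. ?m (y, snd ?a g)) has_derivative
      (\<lambda>v. frechet_derivative ?m (at (snd ?b p, snd ?a g)) (v, 0))) (at (snd ?b p))"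
    using has_derivative_compose[OF p, of ?m] mult_rep_has_derivative[of ?b ?a ?c p g] by simp
  have ev: "\<forall>\<^sub>F y in nhds (snd ?b p). ?m (y, snd ?a g) = (snd ?c \<circ> (\<lambda>h. h \<otimes> g) \<circ> chart_inv ?b) y"
    using eventually_chart_image[OF atlas_chart(1,2), of p]
    by eventually_elim (auto simp: mult_rep_eq chart_inv_chart)
  have "((snd ?c \<circ> (\<lambda>h. h \<otimes> g) \<circ> chart_inv ?b) has_derivative
      (\<lambda>v. frechet_derivative ?m (at (snd ?b p, snd ?a g)) (v, 0))) (at (snd ?b p))"
    by (rule has_derivative_eventually_eq[OF d ev])
  then show ?thesis
    unfolding mdiff_def differentiable_def using isCont_mult_right by blast
qed

section \<open>Conjugation and its tangent map at the identity\<close>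

lemma conj_mdiff: "mdiff A A (\<lambda>h. inv g \<otimes> h \<otimes> g) p"
  using mdiff_comp(1)[OF atlas atlas mult_left_mdiff mult_right_mdiff] .

lemma bounded_linear_Ad: "bounded_linear (Ad G A g)"
  unfolding Ad_def by (rule mdiff_bounded_linear[OF conj_mdiff])

text \<open>Conjugation by \<open>g\<close> is
  \<open>h \<mapsto> inv g \<otimes> h \<otimes> g\<close>, which reverses products. It fixes
  \<open>\<one>\<close>, so the chain rule composes two tangent maps at the same point.\<close>

lemma Ad_mult: "Ad G A (g \<otimes> h) \<eta> = Ad G A h (Ad G A g \<eta>)"
proof -
  have "(\<lambda>x. inv (g \<otimes> h) \<otimes> x \<otimes> (g \<otimes> h)) = (\<lambda>x. inv h \<otimes> (inv g \<otimes> x \<otimes> g) \<otimes> h)"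
    by (simp add: inv_mult_group m_assoc)
  moreover have "inv g \<otimes> \<one> \<otimes> g = \<one>" by simp
  ultimately show ?thesis
    unfolding Ad_def using mdiff_comp(2)[OF atlas atlas conj_mdiff conj_mdiff, of h g \<one>] by simp
qed

lemma Ad_one: "Ad G A \<one> \<eta> = \<eta>"
  unfolding Ad_def using tangent_map_id[OF atlas, of \<one>] by simp

text \<open>Expanding over a finite orthogonal spanning set, obtained from
  \<open>finite_dim\<close>, writes \<open>f\<close> as a finite sum of bounded coordinate
  functionals times fixed vectors.\<close>

lemma linear_imp_bounded_linear:
  fixes f :: "'e \<Rightarrow> 'f::real_normed_vector"
  assumes "linear f"
  shows "bounded_linear f"
proof -
  obtain C :: "'e set" where C: "finite C" "pairwise orthogonal C" "span C = UNIV"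
    using finite_dim basis_orthogonal by metis
  have eq: "f x = (\<Sum>c\<in>C. (x \<bullet> c / (c \<bullet> c)) *\<^sub>R f c)" for x
    by (subst orthogonal_expansion[OF C(1,2), of x])
       (use C(3) in \<open>simp_all add: linear_sum[OF assms] linear_scale[OF assms]\<close>)
  have "bounded_linear (\<lambda>x. \<Sum>c\<in>C. (x \<bullet> c / (c \<bullet> c)) *\<^sub>R f c)"
  proof (rule bounded_linear_sum)
    fix c :: 'e
    have "bounded_linear (\<lambda>x. x \<bullet> c / (c \<bullet> c))"
      by (rule bounded_linear_compose[OF bounded_linear_divide bounded_linear_inner_left])
    then show "bounded_linear (\<lambda>x. (x \<bullet> c / (c \<bullet> c)) *\<^sub>R f c)"
      by (rule bounded_linear_compose[OF bounded_linear_scaleR_left])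
  qed
  then show ?thesis unfolding eq[symmetric] .
qed

text \<open>
  For \<open>g\<close> near \<open>\<one>\<close> the conjugation is \<open>h \<mapsto> m(m(inv g, h), g)\<close> with \<open>m\<close> the multiplication in one
  single chart, so that the dependence of \<open>Ad\<close> on \<open>g\<close> is read off from the differential of \<open>m\<close>.
\<close>

lemma Ad_eq_mult_rep:
  fixes g
  defines "a \<equiv> chart_at A \<one>"
  defines "m \<equiv> mult_rep a a a"
  assumes g: "g \<in> fst a" "inv g \<in> fst a"
  shows "Ad G A g \<eta> = frechet_derivative m (at (snd a (inv g), snd a g))
    (frechet_derivative m (at (snd a (inv g), snd a \<one>)) (0, \<eta>), 0)"
proof -
  have a: "is_chart a" "\<one> \<in> fst a" "a \<in> A" unfolding a_def by simp_all
  let ?u = "snd a (inv g)" and ?x = "snd a g" and ?e = "snd a \<one>"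
  let ?D1 = "frechet_derivative m (at (?u, ?e))" and ?D2 = "frechet_derivative m (at (?u, ?x))"
  have D1: "(m has_derivative ?D1) (at (?u, ?e))"
    unfolding m_def by (rule mult_rep_has_derivative) (use a g in auto)
  have D2: "(m has_derivative ?D2) (at (?u, ?x))"
    unfolding m_def by (rule mult_rep_has_derivative) (use a g in auto)
  \<comment> \<open>This is why the outer differential is taken at (\<open>?u\<close>,
    \<open>?x\<close>).\<close>
  have mu: "m (?u, ?e) = ?u"
    unfolding m_def using a g by (simp add: mult_rep_eq)
  have "((\<lambda>y. (?u, y)) has_derivative (\<lambda>v. (0, v))) (at ?e)"
    by (auto intro!: derivative_eq_intros)
  from has_derivative_compose[OF this D1]
  have "((\<lambda>y. (m (?u, y), ?x)) has_derivative (\<lambda>v. (?D1 (0, v), 0))) (at ?e)"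
    by (auto intro!: derivative_eq_intros)
  from has_derivative_compose[OF this, of m ?D2] D2
  have d: "((\<lambda>y. m (m (?u, y), ?x)) has_derivative (\<lambda>v. ?D2 (?D1 (0, v), 0))) (at ?e)"
    by (simp add: mu)
  \<comment> \<open>The outer \<open>m\<close> computes the product only if
    \<open>inv g \<otimes> h\<close> lies in the chart; for \<open>h\<close> near
    \<open>\<one>\<close> it does, because \<open>inv g\<close> does and the domain is open.\<close>
  have "open (fst a)" using a(1) unfolding is_chart_def by blast
  from eventually_chart_inv[OF a(1,2) isCont_mult_left this, of "inv g"] g
  have "\<forall>\<^sub>F y in nhds ?e. inv g \<otimes> chart_inv a y \<in> fst a" by simp
  then have ev: "\<forall>\<^sub>F y in nhds ?e. m (m (?u, y), ?x) = (snd a \<circ> (\<lambda>h. inv g \<otimes> h \<otimes> g) \<circ> chart_inv a) y"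
    using eventually_chart_image[OF a(1,2)]
  proof eventually_elim
    case (elim y)
    then obtain h where h: "h \<in> fst a" "y = snd a h" by blast
    then show ?case
      using elim(1) unfolding m_def using a g by (simp add: mult_rep_eq chart_inv_chart)
  qed
  have "inv g \<otimes> \<one> \<otimes> g = \<one>" by simp
  then show ?thesis
    using frechet_derivative_at[OF has_derivative_eventually_eq[OF d ev]]
    unfolding Ad_def tangent_map_def a_def[symmetric] by (simp add: fun_eq_iff a_def comp_def)
qed

section \<open>Differentiating \<open>Ad\<close>: the bracket and its bilinearity\<close>

text \<open>In the chart formula one differential of the multiplication is applied to the value of
  another, so base point and direction both vary with \<open>x\<close>. Smoothness controls a
  differential in a fixed direction, so the moving direction is expanded over a finite orthogonal
  spanning set.\<close>

lemma Ad_differentiable: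
  "(\<lambda>x. Ad G A (chart_inv (chart_at A \<one>) x) \<eta>) differentiable (at (snd (chart_at A \<one>) \<one>))"
proof -
  define a where "a = chart_at A \<one>"
  define m where "m = mult_rep a a a"
  define i where "i = snd a \<circ> (\<lambda>g. inv g) \<circ> chart_inv a"
  let ?e = "snd a \<one>"
  let ?D = "\<lambda>v p. frechet_derivative m (at p) v"
  have a: "is_chart a" "\<one> \<in> fst a" "a \<in> A" unfolding a_def by simp_all
  have "open (fst a)" using a(1) unfolding is_chart_def by blast
  obtain C :: "'e set" where C: "finite C" "pairwise orthogonal C" "span C = UNIV"
    using finite_dim basis_orthogonal by metis
  have ie: "i ?e = ?e" unfolding i_def using a by (simp add: chart_inv_chart)
  have "smooth_on (snd a ` (fst a \<inter> UNIV \<inter> (\<lambda>g. inv g) -` fst a)) i"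
    using smooth_inv a(3) unfolding smooth_map_on_def i_def by blast
  then have i: "i differentiable (at ?e)"
    by (rule smooth_on_imp_differentiable) (use a in auto)
  \<comment> \<open>Second derivatives enter here: the differential of \<open>m\<close> in a fixed
    direction is again smooth.\<close>
  have D: "?D v differentiable (at (?e, ?e))" for v
    unfolding m_def
    by (rule smooth_on_imp_differentiable[OF smooth_on_frechet_derivative[OF mult_rep_smooth]])
       (use a in \<open>auto intro!: exI[of _ \<one>]\<close>)
  have "(\<lambda>x. (i x, ?e)) differentiable (at ?e)" "(\<lambda>x. (i x, x)) differentiable (at ?e)"
    using i by (auto intro!: differentiable_Pair)
  then have D1: "(\<lambda>x. ?D v (i x, ?e)) differentiable (at ?e)"
    and D2: "(\<lambda>x. ?D v (i x, x)) differentiable (at ?e)" for v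
    using D[of v] differentiable_chain_at[of "\<lambda>x. (i x, ?e)" ?e "?D v"]
      differentiable_chain_at[of "\<lambda>x. (i x, x)" ?e "?D v"] by (auto simp: ie comp_def)
  have "(\<lambda>x. ?D v (i x, ?e) \<bullet> c) differentiable (at ?e)" for v c
    using D1[of v] bounded_linear.has_derivative[OF bounded_linear_inner_left]
    unfolding differentiable_def by blast
  then have "(\<lambda>x. ?D v (i x, ?e) \<bullet> c / (c \<bullet> c)) differentiable (at ?e)" for v c
    using bounded_linear.has_derivative[OF bounded_linear_divide]
    unfolding differentiable_def by blast
  then have sum: "(\<lambda>x. \<Sum>c\<in>C. (?D (0, \<eta>) (i x, ?e) \<bullet> c / (c \<bullet> c)) *\<^sub>R ?D (c, 0) (i x, x))
      differentiable (at ?e)"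
    using C(1) D2 by (intro differentiable_sum differentiable_scaleR ballI) auto
  have "\<forall>\<^sub>F x in nhds ?e. inv (chart_inv a x) \<in> fst a"
    using eventually_chart_inv[OF a(1,2) isCont_inv \<open>open (fst a)\<close>] a by simp
  \<comment> \<open>The chart formula for \<open>Ad\<close> needs both \<open>g\<close> and
    \<open>inv g\<close> in the chart of \<open>\<one>\<close>, which holds for coordinates near
    \<open>?e\<close>.\<close>
  then have ev: "\<forall>\<^sub>F x in nhds ?e.
      (\<Sum>c\<in>C. (?D (0, \<eta>) (i x, ?e) \<bullet> c / (c \<bullet> c)) *\<^sub>R ?D (c, 0) (i x, x)) = Ad G A (chart_inv a x) \<eta>"
    using eventually_chart_image[OF a(1,2)]
  proof eventually_elim
    case (elim x)
    then obtain g where g: "g \<in> fst a" "x = snd a g" by blast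
    have gx: "chart_inv a x = g" using g a by (simp add: chart_inv_chart)
    have ig: "i x = snd a (inv g)" unfolding i_def by (simp add: gx)
    have gi: "inv g \<in> fst a" using elim(1) gx by simp
    let ?w = "?D (0, \<eta>) (i x, ?e)"
    have "bounded_linear (\<lambda>v. ?D v (i x, x))"
      unfolding ig unfolding g(2) m_def
      by (rule has_derivative_bounded_linear[OF mult_rep_has_derivative]) (use a g gi in auto)
    then have "linear (\<lambda>v. ?D v (i x, x) :: 'e)" by (rule bounded_linear.linear)
    moreover have "linear (\<lambda>w::'e. (w, 0::'e))" by (simp add: linear_iff)
    ultimately have lin: "linear (\<lambda>w. ?D (w, 0) (i x, x))"
      using linear_compose[of "\<lambda>w::'e. (w, 0::'e)" "\<lambda>v. ?D v (i x, x)"] by (simp add: comp_def)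
    have "(\<Sum>c\<in>C. (?w \<bullet> c / (c \<bullet> c)) *\<^sub>R ?D (c, 0) (i x, x))
        = ?D (\<Sum>c\<in>C. (?w \<bullet> c / (c \<bullet> c)) *\<^sub>R c, 0) (i x, x)"
      by (simp add: linear_sum[OF lin] linear_scale[OF lin])
    also have "\<dots> = ?D (?w, 0) (i x, x)"
      using orthogonal_expansion[OF C(1,2), of ?w] C(3) by simp
    also have "\<dots> = Ad G A g \<eta>"
      unfolding ig unfolding g(2) m_def a_def
      using Ad_eq_mult_rep[of g \<eta>] g(1) gi by (simp add: a_def)
    finally show ?case by (simp add: gx)
  qed
  then show ?thesis
    using sum has_derivative_eventually_eq[OF _ ev] unfolding differentiable_def a_def by blast
qed

lemma ad_eq:
  "ad G A \<xi> \<eta> = frechet_derivative (\<lambda>x. Ad G A (chart_inv (chart_at A \<one>) x) \<eta>)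
     (at (snd (chart_at A \<one>) \<one>)) \<xi>"
  unfolding ad_def tangent_map_def by (simp add: chart_at_eucl_atlas comp_def)

lemma ad_has_derivative:
  "((\<lambda>x. Ad G A (chart_inv (chart_at A \<one>) x) \<eta>) has_derivative (\<lambda>\<xi>. ad G A \<xi> \<eta>))
     (at (snd (chart_at A \<one>) \<one>))"
  using Ad_differentiable unfolding ad_eq by (simp add: frechet_derivative_works)

lemma bounded_linear_ad_left: "bounded_linear (\<lambda>\<xi>. ad G A \<xi> \<eta>)"
  by (rule has_derivative_bounded_linear[OF ad_has_derivative])

text \<open>Each \<open>Ad\<close> is linear, and uniqueness of derivatives carries this over to the
  derivative in the group variable; finite dimension then gives boundedness.\<close>

lemma bounded_linear_ad_right: "bounded_linear (ad G A \<xi>)"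
proof (rule linear_imp_bounded_linear, rule linearI)
  note Ad_linear = bounded_linear.linear[OF bounded_linear_Ad]
  show "ad G A \<xi> (\<eta> + \<zeta>) = ad G A \<xi> \<eta> + ad G A \<xi> \<zeta>" for \<eta> \<zeta>
    using has_derivative_unique[OF ad_has_derivative[of "\<eta> + \<zeta>"]]
      has_derivative_add[OF ad_has_derivative[of \<eta>] ad_has_derivative[of \<zeta>]]
    by (simp add: linear_add[OF Ad_linear] fun_eq_iff)
  show "ad G A \<xi> (r *\<^sub>R \<eta>) = r *\<^sub>R ad G A \<xi> \<eta>" for r \<eta>
    using has_derivative_unique[OF ad_has_derivative[of "r *\<^sub>R \<eta>"]]
      has_derivative_scaleR_right[OF ad_has_derivative[of \<eta>], of r]
    by (simp add: linear_scale[OF Ad_linear] fun_eq_iff)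
qed

section \<open>The coadjoint operators and their product rule\<close>

text \<open>\<open>Blinfun\<close> is faithful only on bounded linear maps. Boundedness of
  \<open>ad\<close> in its second argument turns the transpose into a composition of bounded
  operators, hence bounded linear in \<mu>.\<close>

lemma ad_star_eq: "ad_star G A \<xi> \<mu> = \<mu> o\<^sub>L Blinfun (ad G A \<xi>)"
  unfolding ad_star_def
  by (rule blinfun_eqI)
     (simp add: bounded_linear_Blinfun_apply bounded_linear_ad_right
        bounded_linear_compose[OF blinfun.bounded_linear_right])

lemma ad_star_apply: "blinfun_apply (ad_star G A \<xi> \<mu>) \<eta> = blinfun_apply \<mu> (ad G A \<xi> \<eta>)"
  by (simp add: ad_star_eq bounded_linear_Blinfun_apply bounded_linear_ad_right)

lemma bounded_linear_ad_star: "bounded_linear (ad_star G A \<xi>)"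
  unfolding ad_star_eq[abs_def]
  by (rule bounded_bilinear.bounded_linear_left[OF bounded_bilinear_blinfun_compose])

lemma linear_ad_star_left: "linear (\<lambda>\<xi>. ad_star G A \<xi> \<mu>)"
proof (rule linearI)
  note lin = bounded_linear.linear[OF bounded_linear_ad_left]
  show "ad_star G A (x + y) \<mu> = ad_star G A x \<mu> + ad_star G A y \<mu>" for x y
    by (rule blinfun_eqI)
       (simp add: ad_star_apply blinfun.add_left blinfun.add_right linear_add[OF lin])
  show "ad_star G A (r *\<^sub>R x) \<mu> = r *\<^sub>R ad_star G A x \<mu>" for r x
    by (rule blinfun_eqI)
       (simp add: ad_star_apply blinfun.scaleR_left blinfun.scaleR_right linear_scale[OF lin])
qed

text \<open>Expanding \<xi> over an orthogonal spanning set leaves scalar functions times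
  \<open>ad_star G A c (\<mu> s)\<close> with \<open>c\<close> fixed, so linearity in \<xi> and
  bounded linearity in \<mu> yield the Leibniz rule.\<close>

lemma has_vector_derivative_ad_star:
  assumes \<xi>: "(\<xi> has_vector_derivative \<xi>') (at t)" and \<mu>: "(\<mu> has_vector_derivative \<mu>') (at t)"
  shows "((\<lambda>s. ad_star G A (\<xi> s) (\<mu> s)) has_vector_derivative
    ad_star G A \<xi>' (\<mu> t) + ad_star G A (\<xi> t) \<mu>') (at t)"
proof -
  obtain C :: "'e set" where C: "finite C" "pairwise orthogonal C" "span C = UNIV"
    using finite_dim basis_orthogonal by metis
  have expand: "ad_star G A x \<nu> = (\<Sum>c\<in>C. (x \<bullet> c / (c \<bullet> c)) *\<^sub>R ad_star G A c \<nu>)" for x \<nu>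
    by (subst orthogonal_expansion[OF C(1,2), of x])
       (use C(3) in \<open>simp_all add: linear_sum[OF linear_ad_star_left] linear_scale[OF linear_ad_star_left]\<close>)
  have *: "((\<lambda>s. (\<xi> s \<bullet> c / (c \<bullet> c)) *\<^sub>R ad_star G A c (\<mu> s)) has_vector_derivative
      (\<xi> t \<bullet> c / (c \<bullet> c)) *\<^sub>R ad_star G A c \<mu>' + (\<xi>' \<bullet> c / (c \<bullet> c)) *\<^sub>R ad_star G A c (\<mu> t)) (at t)" for c
  proof -
    have "((\<lambda>s. \<xi> s \<bullet> c) has_vector_derivative \<xi>' \<bullet> c) (at t)"
      by (rule bounded_linear.has_vector_derivative[OF bounded_linear_inner_left \<xi>])
    then have "((\<lambda>s. \<xi> s \<bullet> c / (c \<bullet> c)) has_vector_derivative \<xi>' \<bullet> c / (c \<bullet> c)) (at t)"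
      by (rule bounded_linear.has_vector_derivative[OF bounded_linear_divide])
    moreover have "((\<lambda>s. ad_star G A c (\<mu> s)) has_vector_derivative ad_star G A c \<mu>') (at t)"
      by (rule bounded_linear.has_vector_derivative[OF bounded_linear_ad_star \<mu>])
    ultimately show ?thesis
      by (rule bounded_bilinear.has_vector_derivative[OF bounded_bilinear_scaleR])
  qed
  have "(\<lambda>s. ad_star G A (\<xi> s) (\<mu> s)) = (\<lambda>s. \<Sum>c\<in>C. (\<xi> s \<bullet> c / (c \<bullet> c)) *\<^sub>R ad_star G A c (\<mu> s))"
    by (rule ext) (rule expand)
  moreover have "ad_star G A \<xi>' (\<mu> t) + ad_star G A (\<xi> t) \<mu>' =
      (\<Sum>c\<in>C. (\<xi> t \<bullet> c / (c \<bullet> c)) *\<^sub>R ad_star G A c \<mu>' + (\<xi>' \<bullet> c / (c \<bullet> c)) *\<^sub>R ad_star G A c (\<mu> t))"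
    unfolding sum.distrib expand[of \<xi>' "\<mu> t"] expand[of "\<xi> t" \<mu>'] by (rule add.commute)
  moreover note has_vector_derivative_sum[of C, OF *]
  ultimately show ?thesis by (simp only:)
qed

section \<open>The Euler--Lagrange equations on second order curves\<close>

text \<open>On a second order curve the third slot is the derivative of \<xi>, so the last term of
  the first equation is the part of \<open>dq/dt\<close> in which \<xi> is differentiated.\<close>

lemma trivialized_EL_imp_second_order_EL:
  assumes \<xi>: "\<And>t. t \<in> I \<Longrightarrow> \<xi> differentiable (at t)"
    and EL: "trivialized_EL G A L I (second_order_curve g \<xi>)"
  shows "second_order_EL G A L I g \<xi>"
proof -
  define c where "c = second_order_curve g \<xi>"
  let ?p = "\<lambda>s. deriv_xi2 L (c s)" and ?r = "\<lambda>s. deriv_xi3 L (c s)"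
  let ?q = "\<lambda>s. ad_star G A (\<xi> s) (?r s)"
  have r: "(?r has_vector_derivative ?q t) (at t)" if "t \<in> I" for t
    using EL that unfolding trivialized_EL_def EL_second_def
    by (auto simp: c_def second_order_curve_def)
  have coad: "coad_eq G A \<xi> (\<lambda>s. ?p s - ?q s) (cotangent_right G A (g t) (deriv_group A L (c t))) t"
    if t: "t \<in> I" for t
  proof -
    let ?\<xi>' = "vector_derivative \<xi> (at t)" and ?F = "cotangent_right G A (g t) (deriv_group A L (c t))"
    have "(\<xi> has_vector_derivative ?\<xi>') (at t)"
      using \<xi>[OF t] by (simp add: vector_derivative_works)
    note q = has_vector_derivative_ad_star[OF this r[OF t]]
    have p: "(?p has_vector_derivative ?F + ad_star G A (\<xi> t) (?p t) + ad_star G A ?\<xi>' (?r t)) (at t)"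
      using EL t unfolding trivialized_EL_def EL_first_def
      by (auto simp: c_def second_order_curve_def)
    \<comment> \<open>The terms in \<open>?\<xi>'\<close> cancel, and linearity of
      \<open>ad_star\<close> in the momentum collects the rest.\<close>
    show ?thesis
      unfolding coad_eq_def
      by (intro exI conjI, rule has_vector_derivative_diff[OF p q])
         (simp add: linear_diff[OF bounded_linear.linear[OF bounded_linear_ad_star]])
  qed
  show ?thesis
    unfolding second_order_EL_def Let_def c_def[symmetric]
    by (intro exI[of _ ?q] conjI ballI r coad)
qed

text \<open>The momentum \<open>?p\<close> is recovered as the sum of \<open>?p - q\<close> and
  \<open>q\<close>: the first is differentiable by the second order equation, the second by the
  Leibniz rule once the second equation gives it the form \<open>?q\<close>.\<close>

lemma second_order_EL_imp_trivialized_EL: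
  assumes I: "open I" and \<xi>: "\<And>t. t \<in> I \<Longrightarrow> \<xi> differentiable (at t)"
    and EL2: "EL_second G A L I (second_order_curve g \<xi>)"
    and EL: "second_order_EL G A L I g \<xi>"
  shows "trivialized_EL G A L I (second_order_curve g \<xi>)"
proof -
  define c where "c = second_order_curve g \<xi>"
  let ?p = "\<lambda>s. deriv_xi2 L (c s)" and ?r = "\<lambda>s. deriv_xi3 L (c s)"
  let ?q = "\<lambda>s. ad_star G A (\<xi> s) (?r s)"
  let ?F = "\<lambda>t. cotangent_right G A (g t) (deriv_group A L (c t))"
  have r: "(?r has_vector_derivative ?q t) (at t)" if "t \<in> I" for t
    using EL2 that unfolding EL_second_def by (auto simp: c_def second_order_curve_def)
  obtain q where q: "\<And>t. t \<in> I \<Longrightarrow> (?r has_vector_derivative q t) (at t)"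
    and coad: "\<And>t. t \<in> I \<Longrightarrow> coad_eq G A \<xi> (\<lambda>s. ?p s - q s) (?F t) t"
    using EL unfolding second_order_EL_def Let_def c_def by blast
  \<comment> \<open>The \<open>q\<close> of the second order equation is known only as a time
    derivative; uniqueness identifies it on \<open>I\<close>.\<close>
  have q_eq: "q t = ?q t" if "t \<in> I" for t
    using vector_derivative_unique_at[OF q[OF that] r[OF that]] .
  have "(?p has_vector_derivative
      ?F t + ad_star G A (\<xi> t) (?p t) + ad_star G A (vector_derivative \<xi> (at t)) (?r t)) (at t)"
    if t: "t \<in> I" for t
  proof -
    have "(\<xi> has_vector_derivative vector_derivative \<xi> (at t)) (at t)"
      using \<xi>[OF t] by (simp add: vector_derivative_works)
    note dq = has_vector_derivative_ad_star[OF this r[OF t]]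
    obtain d where d: "((\<lambda>s. ?p s - q s) has_vector_derivative d) (at t)"
      and d_eq: "d - ad_star G A (\<xi> t) (?p t - q t) = ?F t"
      using coad[OF t] unfolding coad_eq_def by blast
    have "((\<lambda>s. (?p s - q s) + ?q s) has_vector_derivative d + (ad_star G A (vector_derivative \<xi> (at t)) (?r t)
        + ad_star G A (\<xi> t) (?q t))) (at t)"
      by (rule has_vector_derivative_add[OF d dq])
    \<comment> \<open>\<open>q\<close> and \<open>?q\<close> are known to agree on \<open>I\<close>
      only; openness of \<open>I\<close> makes this agreement hold near \<open>t\<close>.\<close>
    then have "(?p has_vector_derivative d + (ad_star G A (vector_derivative \<xi> (at t)) (?r t)
        + ad_star G A (\<xi> t) (?q t))) (at t)"
      by (rule has_vector_derivative_transform_within_open[OF _ I t]) (simp add: q_eq)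
    moreover have "d = ?F t + ad_star G A (\<xi> t) (?p t) - ad_star G A (\<xi> t) (?q t)"
      using d_eq q_eq[OF t]
      by (simp add: linear_diff[OF bounded_linear.linear[OF bounded_linear_ad_star]] algebra_simps)
    ultimately show ?thesis by (simp add: algebra_simps)
  qed
  then have "EL_first G A L I c"
    unfolding EL_first_def by (auto simp: c_def second_order_curve_def)
  then show ?thesis
    using EL2 unfolding trivialized_EL_def c_def by blast
qed

text \<open>The group derivative of \<open>L\<close> vanishes and its other partial derivatives
  along the curve are those of \<open>l\<close>, so the two equations coincide with the same
  \<open>q\<close>.\<close>

lemma second_order_EL_iff_EP:
  assumes L: "\<And>h \<eta> \<zeta>. L (h, \<eta>, \<zeta>) = l (\<eta>, \<zeta>)"
  shows "second_order_EL G A L I g \<xi> \<longleftrightarrow> second_order_EP G A l I \<xi>"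
proof -
  have zero: "Blinfun (\<lambda>v. 0) = (0 :: 'e \<Rightarrow>\<^sub>L real)"
    by (simp add: zero_blinfun.abs_eq)
  have "cotangent_right G A h (deriv_group A L (h, \<eta>, \<zeta>)) = 0"
    and "deriv_xi2 L (h, \<eta>, \<zeta>) = deriv_fst l (\<eta>, \<zeta>)"
    and "deriv_xi3 L (h, \<eta>, \<zeta>) = deriv_snd l (\<eta>, \<zeta>)" for h \<eta> \<zeta>
    unfolding cotangent_right_def deriv_group_def deriv_xi2_def deriv_xi3_def deriv_fst_def deriv_snd_def
    by (simp_all add: L tangent_map_const zero)
  then show ?thesis
    unfolding second_order_EL_def second_order_EP_def Let_def second_order_curve_def by simp
qed

section \<open>The second order tangent group and its quotient\<close>

lemma triv_T2_simps:
  "carrier (triv_T2 G A) = UNIV"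
  "\<one>\<^bsub>triv_T2 G A\<^esub> = (\<one>, 0, 0)"
  "(g, \<xi>, \<xi>') \<otimes>\<^bsub>triv_T2 G A\<^esub> (h, \<eta>, \<eta>') = (g \<otimes> h, \<xi> + Ad G A (inv g) \<eta>, \<xi>' + Ad G A (inv g) \<eta>')"
  unfolding triv_T2_def by simp_all

lemma linear_Ad: "linear (Ad G A g)"
  by (rule bounded_linear.linear[OF bounded_linear_Ad])

text \<open>\<open>Ad\<close> reverses products and so does inversion, so
  \<open>Ad G A (inv g)\<close> is a linear left action; associativity of the semidirect product
  rests on this.\<close>

lemma group_triv_T2: "group (triv_T2 G A)"
proof (rule groupI)
  fix x y z :: "'g \<times> 'e \<times> 'e"
  show "x \<otimes>\<^bsub>triv_T2 G A\<^esub> y \<otimes>\<^bsub>triv_T2 G A\<^esub> z = x \<otimes>\<^bsub>triv_T2 G A\<^esub> (y \<otimes>\<^bsub>triv_T2 G A\<^esub> z)"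
    by (cases x, cases y, cases z)
       (simp add: triv_T2_simps m_assoc inv_mult_group Ad_mult linear_add[OF linear_Ad])
next
  fix x :: "'g \<times> 'e \<times> 'e"
  show "\<one>\<^bsub>triv_T2 G A\<^esub> \<otimes>\<^bsub>triv_T2 G A\<^esub> x = x"
    by (cases x) (simp add: triv_T2_simps Ad_one)
  obtain g \<xi> \<xi>' where x: "x = (g, \<xi>, \<xi>')" by (cases x)
  \<comment> \<open>A left factor \<open>inv g\<close> acts on the vectors of \<open>x\<close> by
    \<open>Ad G A g\<close>, so the left inverse carries the negatives of these images.\<close>
  have "Ad G A (inv (inv g)) v = Ad G A g v" for v by simp
  then have "(inv g, - Ad G A g \<xi>, - Ad G A g \<xi>') \<otimes>\<^bsub>triv_T2 G A\<^esub> x = \<one>\<^bsub>triv_T2 G A\<^esub>"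
    by (simp add: x triv_T2_simps)
  then show "\<exists>y\<in>carrier (triv_T2 G A). y \<otimes>\<^bsub>triv_T2 G A\<^esub> x = \<one>\<^bsub>triv_T2 G A\<^esub>"
    unfolding triv_T2_simps(1) by blast
qed (simp_all add: triv_T2_simps)

lemma embed_G_hom: "embed_G \<in> hom G (triv_T2 G A)"
  by (rule homI) (simp_all add: triv_T2_simps embed_G_def linear_0[OF linear_Ad])

lemma subgroup_range_embed_G: "subgroup (range embed_G) (triv_T2 G A)"
proof -
  interpret group_hom G "triv_T2 G A" embed_G
    by (rule group_hom.intro[OF is_group group_triv_T2 group_hom_axioms.intro[OF embed_G_hom]])
  show ?thesis using img_is_subgroup by (simp add: carrier_UNIV)
qed

section \<open>Orbits and the quotient\<close>

lemma G_action_apply: "G_action G A h (g, v) = (g \<otimes> inv h, v)"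
  by (cases v) (simp add: G_action_def embed_G_def triv_T2_simps linear_0[OF linear_Ad])

lemma group_action_G: "group_action G (carrier (triv_T2 G A)) (G_action G A)"
proof -
  have mult: "G_action G A (h \<otimes> k) x = G_action G A h (G_action G A k x)" for h k x
    by (cases x) (simp add: G_action_apply inv_mult_group m_assoc)
  have one: "G_action G A \<one> x = x" for x
    by (cases x) (simp add: G_action_apply)
  have "bij (G_action G A h)" for h
    by (rule o_bij[of "G_action G A (inv h)"])
       (simp_all add: fun_eq_iff mult[symmetric] one)
  then have "G_action G A \<in> hom G (BijGroup UNIV)"
    by (intro homI) (auto simp: BijGroup_def Bij_def extensional_def compose_def fun_eq_iff mult)
  then show ?thesis
    unfolding group_action_def triv_T2_simps(1) group_hom_def group_hom_axioms_def
    using group_BijGroup is_group by blast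
qed

lemma orbit_G_action: "orbit G (G_action G A) x = UNIV \<times> {snd x}"
proof -
  obtain g v where x: "x = (g, v)" by (cases x)
  have "(k, v) \<in> orbit G (G_action G A) x" for k
  proof -
    \<comment> \<open>\<open>inv k \<otimes> g\<close> is the solution \<open>h\<close> of
      \<open>g \<otimes> inv h = k\<close>.\<close>
    have "G_action G A (inv k \<otimes> g) x = (k, v)"
      by (simp add: x G_action_apply inv_mult_group m_assoc[symmetric])
    then show ?thesis unfolding orbit_def by (metis (mono_tags, lifting) mem_Collect_eq mem_carrier)
  qed
  then show ?thesis
    unfolding x by (auto simp: orbit_def G_action_apply)
qed

lemma orbits_bij:
  "\<exists>\<Phi>. bij_betw \<Phi> (orbits G (carrier (triv_T2 G A)) (G_action G A)) (UNIV :: ('e \<times> 'e) set)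
     \<and> (\<forall>x. \<Phi> (orbit G (G_action G A) x) = snd x)"
proof -
  \<comment> \<open>An orbit projects onto a single point of \<open>'e \<times> 'e\<close>, which
    \<open>the_elem\<close> reads off.\<close>
  define \<Phi> :: "('g \<times> 'e \<times> 'e) set \<Rightarrow> 'e \<times> 'e" where "\<Phi> X = the_elem (snd ` X)" for X
  have \<Phi>: "\<Phi> (UNIV \<times> {v}) = v" for v
    by (simp add: \<Phi>_def)
  have orbits: "orbits G (carrier (triv_T2 G A)) (G_action G A) = range (\<lambda>v. UNIV \<times> {v})"
    unfolding orbits_def triv_T2_simps(1) by (auto simp: orbit_G_action)
  have "bij_betw \<Phi> (range (\<lambda>v. UNIV \<times> {v})) UNIV"
    by (rule bij_betw_byWitness[where f' = "\<lambda>v. UNIV \<times> {v}"]) (auto simp: \<Phi>)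
  then show ?thesis
    unfolding orbits by (metis \<Phi> orbit_G_action)
qed

end

text \<open>The projection is a continuous open surjection. In the application its fibres are the
  orbits, so this adds the topology to the bijection of the orbit space.\<close>

lemma quotient_map_snd_euclidean:
  "quotient_map euclidean euclidean (snd :: 'a::topological_space \<times> 'b::topological_space \<Rightarrow> 'b)"
proof (rule continuous_open_imp_quotient_map)
  show "continuous_map euclidean euclidean (snd :: 'a \<times> 'b \<Rightarrow> 'b)"
    by (simp add: continuous_on_snd)
  show "open_map euclidean euclidean (snd :: 'a \<times> 'b \<Rightarrow> 'b)"
    unfolding open_map_def using open_image_snd by auto
qed auto

text \<open>Given the second equation, the first is equivalent to the second order equation; this is
  the sense of reduction, split into two implications. The quotient is identified both as a set of
  orbits and topologically.\<close>

theorem mainTheorem3: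
  fixes G :: "'g::{t2_space, second_countable_topology} monoid"
    and A :: "('g, 'e::real_inner) chart set"
    and L :: "'g \<times> 'e \<times> 'e \<Rightarrow> real"
  assumes "lie_group G A"
    and "smooth_map_on (prod_atlas A (prod_atlas eucl_atlas eucl_atlas)) eucl_atlas UNIV L"
  shows
    "(\<forall>I g \<xi>. open I \<and> is_interval I \<and> smooth_map_on eucl_atlas A I g \<and> smooth_on I \<xi> \<longrightarrow>
        (trivialized_EL G A L I (canonical_immersion \<circ> second_order_curve g \<xi>) \<longrightarrow>
           second_order_EL G A (L \<circ> canonical_immersion) I g \<xi>) \<and>
        (EL_second G A L I (canonical_immersion \<circ> second_order_curve g \<xi>) \<and>
         second_order_EL G A (L \<circ> canonical_immersion) I g \<xi> \<longrightarrow>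
           trivialized_EL G A L I (canonical_immersion \<circ> second_order_curve g \<xi>)) \<and>
        (\<forall>l. (\<forall>h \<eta> \<zeta>. L (h, \<eta>, \<zeta>) = l (\<eta>, \<zeta>)) \<longrightarrow>
           (trivialized_EL G A L I (canonical_immersion \<circ> second_order_curve g \<xi>) \<longrightarrow>
              second_order_EP G A l I \<xi>) \<and>
           (second_order_EL G A (L \<circ> canonical_immersion) I g \<xi> \<longleftrightarrow>
              second_order_EP G A l I \<xi>)))
     \<and> group (triv_T2 G A)
     \<and> subgroup (range embed_G) (triv_T2 G A)
     \<and> embed_G \<in> hom G (triv_T2 G A)
     \<and> group_action G (carrier (triv_T2 G A)) (G_action G A)
     \<and> (\<exists>\<Phi>. bij_betw \<Phi> (orbits G (carrier (triv_T2 G A)) (G_action G A)) (UNIV :: ('e \<times> 'e) set)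
           \<and> (\<forall>x. \<Phi> (orbit G (G_action G A) x) = snd x))
     \<and> quotient_map euclidean euclidean (snd :: 'g \<times> 'e \<times> 'e \<Rightarrow> 'e \<times> 'e)"
proof -
  interpret lie_group G A by (rule assms(1))
  \<comment> \<open>Source and target consist of the same triples, so the immersion is the identity
    on points and drops out of the composites.\<close>
  have immersion: "canonical_immersion \<circ> c = c" "L \<circ> canonical_immersion = L"
    for c :: "real \<Rightarrow> 'g \<times> 'e \<times> 'e"
    by (auto simp: canonical_immersion_def fun_eq_iff split: prod.split)
  have eqs: "(trivialized_EL G A L I (second_order_curve g \<xi>) \<longrightarrow> second_order_EL G A L I g \<xi>) \<and>
      (EL_second G A L I (second_order_curve g \<xi>) \<and> second_order_EL G A L I g \<xi> \<longrightarrow>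
        trivialized_EL G A L I (second_order_curve g \<xi>)) \<and>
      (\<forall>l. (\<forall>h \<eta> \<zeta>. L (h, \<eta>, \<zeta>) = l (\<eta>, \<zeta>)) \<longrightarrow>
        (trivialized_EL G A L I (second_order_curve g \<xi>) \<longrightarrow> second_order_EP G A l I \<xi>) \<and>
        (second_order_EL G A L I g \<xi> \<longleftrightarrow> second_order_EP G A l I \<xi>))"
    if "open I" "smooth_on I \<xi>" for I g \<xi>
  proof -
    note d = smooth_on_imp_differentiable[OF that(2)]
    have 1: "trivialized_EL G A L I (second_order_curve g \<xi>) \<Longrightarrow> second_order_EL G A L I g \<xi>"
      by (rule trivialized_EL_imp_second_order_EL[OF d])
    have 2: "EL_second G A L I (second_order_curve g \<xi>) \<Longrightarrow> second_order_EL G A L I g \<xi> \<Longrightarrow>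
        trivialized_EL G A L I (second_order_curve g \<xi>)"
      by (rule second_order_EL_imp_trivialized_EL[OF that(1) d])
    have 3: "second_order_EL G A L I g \<xi> \<longleftrightarrow> second_order_EP G A l I \<xi>"
      if "\<forall>h \<eta> \<zeta>. L (h, \<eta>, \<zeta>) = l (\<eta>, \<zeta>)" for l
      using that by (intro second_order_EL_iff_EP) simp
    show ?thesis
    proof (intro conjI allI impI)
      fix l assume l: "\<forall>h \<eta> \<zeta>. L (h, \<eta>, \<zeta>) = l (\<eta>, \<zeta>)"
      show "second_order_EL G A L I g \<xi> \<longleftrightarrow> second_order_EP G A l I \<xi>" by (rule 3[OF l])
      show "second_order_EP G A l I \<xi>" if "trivialized_EL G A L I (second_order_curve g \<xi>)"
        using 1[OF that] 3[OF l] by blast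
    qed (use 1 2 in blast)+
  qed
  show ?thesis
    unfolding immersion
    by (intro conjI, use eqs in simp)
      (fact group_triv_T2 subgroup_range_embed_G embed_G_hom group_action_G orbits_bij
        quotient_map_snd_euclidean)+
qed

end
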